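(* Assume authenticated channels with honest sign-once, and a byte-deterministic encoder, canonicalisation and quantiser. In a successful round $r$ (all honest nodes complete reliable broadcast with the identical delivered view $V(r)$ over $I_r$), if the protocol publishes typed commit objects $\mathcal{O}_i$ and $\mathcal{O}_j$ at two honest verifiers $i,j$ in round $r$, then both objects share the same commit type and the same digest $h^\star$, and both certificates bind $2f+1$ distinct signer identities to $h^\star$.
   Context: There are $n\ge 3f+1$ agents, at most $f$ Byzantine, the rest honest. A delivered view $V(r)$ consists of an index set $I_r$ of agents with $|I_r|\ge n-f$ and, for each $i\in I_r$, a structured proposal $\rho_i$ (containing a verdict in $\{\textsc{support},\textsc{refute},\textsc{insufficient}\}$) and its unit-norm embedding $\mathbf{e}_i\in\mathbb{S}^{d-1}$ computed by an encoder from a canonical serialisation of $\rho_i$. $\pi$ is a frozen parameter tuple (shared by all nodes) with digest $h_\pi$, and $H$ is a collision-resistant hash function. Protocol (H-CSC), executed by each honest node on its delivered view: (Stage 2) let $G_v$ be the delivered agents with verdict $v$, $v^\star=\arg\max_v|G_v|$ (ties: $\textsc{support}>\textsc{refute}>\textsc{insufficient}$), $\textit{verdict\_margin}=|G_{v^\star}|-\max_{v\neq v^\star}|G_v|$; abort if $|G_{v^\star}|<2f+1$. (Stage 3) let $\widehat{C}$ be the largest connected component (deterministic tie-break) of the graph on $G_{v^\star}$ joining pairs at angle $\le\theta_\alpha$; the semantic path is ok if $|\widehat{C}|\ge 2f+1$ and some $h\in\widehat{C}$ is within angle $\theta_\alpha$ of all members. (Stage 4a) if ok, compute a deterministic robust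 aggregate $\mathbf{y}^\star$ of $\{\mathbf{e}_i:i\in\widehat{C}\}$ (geometric median; abort if degenerate; then normalise), quantise it to $\widetilde{\mathbf{y}}=Q_\eta(\mathbf{y}^\star)$, and set the digest $h^\star=H(\texttt{"semantic\_commit"}\Vert\widetilde{\mathbf{y}}\Vert h_\pi\Vert r\Vert v^\star)$, commit type $\textsc{semantic\_commit}$, signer source $\widehat{C}$. (Stage 4b) otherwise, if $\textit{verdict\_margin}\ge 1$, set $h^\star=H(\texttt{"verdict\_commit"}\Vert P\Vert h_\pi\Vert r)$ with $P$ a canonical serialisation of $(v^\star,|G_{v^\star}|,\textit{verdict\_margin},n,f,r)$, commit type $\textsc{verdict\_commit}$, signer source $G_{v^\star}$; otherwise abort. (Stage 5) collect valid signatures on $h^\star$ from agents in the signer source, counting at most one per identity; abort if fewer than $2f+1$ distinct signers; otherwise publish a typed commit object containing the commit type, $h^\star$, and the certificate (the set of signatures). Authenticated channels and honest sign-once: honest agents' signatures are unforgeable; in each round an honest agent signs at most one typed digest, namely the unique digest $h^\star$ obtained by running the H-CSC decision rule (verdict grouping in Stage 2, core extraction and admissibility check in Stage 3, digest construction in Stage 4a or Stage 4b) locally on its delivered view $V(r)$, and refuses any other. Deterministic encoder: two honest agents computing the embedding of the same canonical text obtain the identical bit pattern; canonicalisation is byte-deterministic; the quantiser $Q_\eta$ is a fixed-point lattice rounding with step $\eta$ and fixed tie-break rule. *)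

theory Defs
  imports "HOL-Analysis.Analysis" "HOL-Library.Multiset"
begin

text \<open>Byte strings are lists of \<^typ>\<open>char\<close>, i.e. of 8-bit characters.\<close>

type_synonym bytes = string

datatype verdict = Support | Refute | Insufficient

record 'c proposal =
  verdict :: verdict
  content :: 'c

text \<open>
  A delivered view maps each agent of the index set \<open>I\<^sub>r\<close> (the domain of the map) to its proposal
  together with the embedding of that proposal.
\<close>

type_synonym ('a, 'c, 'd) view = "'a \<Rightarrow> ('c proposal \<times> (real ^ 'd)) option"

text \<open>
  Everything that is turned into bytes: proposals (the text read by the encoder), quantised
  aggregates, rounds, verdicts, and the payload
  \<open>(v\<^sup>\<star>, |G\<^sub>v\<^sub>\<star>|, verdict_margin, n, f, r)\<close>.
\<close>

datatype ('c, 'd::finite) item =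
    Proposal "'c proposal"
  | Point "real ^ 'd"
  | Round nat
  | Verdict verdict
  | Payload verdict nat int nat nat nat

text \<open>
  The functions a node evaluates with its own software. They are kept separate for each node, so
  that byte-determinism across nodes is a hypothesis and not built into the model.
\<close>

record ('c, 'd) tools =
  canon :: "('c, 'd) item \<Rightarrow> bytes"
  encoder :: "bytes \<Rightarrow> real ^ 'd"
  quantiser :: "real ^ 'd \<Rightarrow> real ^ 'd"

text \<open>
  The frozen parameters \<open>\<pi>\<close>: the angle \<open>\<theta>\<^sub>\<alpha>\<close>, the quantiser step \<open>\<eta>\<close>, the tie-break among the
  largest components, the selection of a geometric median (which need not be unique), and the
  test for degenerate aggregates, applied to the embeddings and their median.
\<close>

record ('a, 'd) params =
  theta :: real
  eta :: real
  tie_break :: "'a set set \<Rightarrow> 'a set"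
  median :: "(real ^ 'd) multiset \<Rightarrow> real ^ 'd"
  degenerate :: "(real ^ 'd) multiset \<Rightarrow> real ^ 'd \<Rightarrow> bool"

datatype commit_type = Semantic_commit | Verdict_commit

record ('a, 's) commit_object =
  ctype :: commit_type
  digest :: bytes
  cert :: "('a \<times> 's) set"

text \<open>
  \<open>faults\<close> is \<open>f\<close>, \<open>hash\<close> is \<open>H\<close> and \<open>pi_digest\<close> is \<open>h\<^sub>\<pi>\<close>. No property of \<open>hash\<close> is assumed:
  collision resistance is a computational notion, and an arbitrary function covers every
  collision-resistant one.
  \<open>delivered k r\<close> is what reliable broadcast outputs at node \<open>k\<close> in round \<open>r\<close>, namely the delivered
  proposals indexed by \<open>I\<^sub>r\<close>, or \<open>None\<close> if \<open>k\<close> does not complete it.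
  \<open>verify s h \<sigma>\<close> says that \<open>\<sigma>\<close> is a valid signature on \<open>h\<close> under the key of \<open>s\<close>,
  \<open>inbox k r\<close> contains the signatures received by \<open>k\<close> in round \<open>r\<close>, each with its claimed signer, and
  \<open>signed s r\<close> contains the typed digests actually signed by \<open>s\<close> in round \<open>r\<close>.
\<close>

record ('a, 'c, 'd, 's) system =
  agents :: "'a set"
  byzantine :: "'a set"
  faults :: nat
  params :: "('a, 'd) params"
  hash :: "bytes \<Rightarrow> bytes"
  pi_digest :: bytes
  tools :: "'a \<Rightarrow> ('c, 'd) tools"
  delivered :: "'a \<Rightarrow> nat \<Rightarrow> ('a \<Rightarrow> 'c proposal option) option"
  verify :: "'a \<Rightarrow> bytes \<Rightarrow> 's \<Rightarrow> bool"
  inbox :: "'a \<Rightarrow> nat \<Rightarrow> ('a \<times> 's) set"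
  signed :: "'a \<Rightarrow> nat \<Rightarrow> (commit_type \<times> bytes) set"

definition honest :: "('a, 'c, 'd::finite, 's) system \<Rightarrow> 'a set" where
  "honest S = agents S - byzantine S"

text \<open>
  A node completes the delivered proposals to its view by embedding their canonical
  serialisations with its own tools.
\<close>

definition attach_embeddings ::
    "('c, 'd::finite) tools \<Rightarrow> ('a \<Rightarrow> 'c proposal option) \<Rightarrow> ('a, 'c, 'd) view" where
  "attach_embeddings T D = map_option (\<lambda>\<rho>. (\<rho>, encoder T (canon T (Proposal \<rho>)))) \<circ> D"

definition local_view ::
    "('a, 'c, 'd::finite, 's) system \<Rightarrow> 'a \<Rightarrow> nat \<Rightarrow> ('a, 'c, 'd) view option" where
  "local_view S k r = map_option (attach_embeddings (tools S k)) (delivered S k r)"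


subsection \<open>Stage 2: verdict grouping\<close>

definition verdict_group :: "('a, 'c, 'd::finite) view \<Rightarrow> verdict \<Rightarrow> 'a set" where
  "verdict_group V v = {i \<in> dom V. verdict (fst (the (V i))) = v}"

definition leading :: "('a, 'c, 'd::finite) view \<Rightarrow> verdict" where
  "leading V =
    (if card (verdict_group V Refute) \<le> card (verdict_group V Support) \<and>
        card (verdict_group V Insufficient) \<le> card (verdict_group V Support) then Support
     else if card (verdict_group V Insufficient) \<le> card (verdict_group V Refute) then Refute
     else Insufficient)"

definition verdict_margin :: "('a, 'c, 'd::finite) view \<Rightarrow> int" where
  "verdict_margin V = int (card (verdict_group V (leading V))) -
     int (Max ((\<lambda>v. card (verdict_group V v)) ` (UNIV - {leading V})))"


subsection \<open>Stage 3: semantic core\<close>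

definition embedding :: "('a, 'c, 'd::finite) view \<Rightarrow> 'a \<Rightarrow> real ^ 'd" where
  "embedding V i = snd (the (V i))"

text \<open>Embeddings are unit vectors, so the angle needs no normalisation.\<close>

definition angle :: "real ^ 'd::finite \<Rightarrow> real ^ 'd \<Rightarrow> real" where
  "angle x y = arccos (x \<bullet> y)"

definition angle_graph ::
    "('a, 'd::finite) params \<Rightarrow> ('a, 'c, 'd) view \<Rightarrow> 'a set \<Rightarrow> ('a \<times> 'a) set" where
  "angle_graph \<pi> V G = {(i, j). i \<in> G \<and> j \<in> G \<and> i \<noteq> j \<and>
     angle (embedding V i) (embedding V j) \<le> theta \<pi>}"

text \<open>The edge relation is symmetric, so its reachability classes are the connected components.\<close>

definition angle_components ::
    "('a, 'd::finite) params \<Rightarrow> ('a, 'c, 'd) view \<Rightarrow> 'a set \<Rightarrow> 'a set set" where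
  "angle_components \<pi> V G = G // (angle_graph \<pi> V G)\<^sup>*"

definition core :: "('a, 'd::finite) params \<Rightarrow> ('a, 'c, 'd) view \<Rightarrow> 'a set" where
  "core \<pi> V =
    (let K = angle_components \<pi> V (verdict_group V (leading V))
     in tie_break \<pi> {C \<in> K. \<forall>C' \<in> K. card C' \<le> card C})"

definition semantic_ok ::
    "('a, 'd::finite) params \<Rightarrow> nat \<Rightarrow> ('a, 'c, 'd) view \<Rightarrow> bool" where
  "semantic_ok \<pi> f V \<longleftrightarrow> 2 * f + 1 \<le> card (core \<pi> V) \<and>
     (\<exists>h \<in> core \<pi> V. \<forall>i \<in> core \<pi> V. angle (embedding V h) (embedding V i) \<le> theta \<pi>)"


subsection \<open>Stage 4: digest\<close>

definition is_geometric_median :: "(real ^ 'd::finite) multiset \<Rightarrow> real ^ 'd \<Rightarrow> bool" where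
  "is_geometric_median M y \<longleftrightarrow>
     (\<forall>z. (\<Sum>e \<in># M. norm (y - e)) \<le> (\<Sum>e \<in># M. norm (z - e)))"

definition core_embeddings ::
    "('a, 'd::finite) params \<Rightarrow> ('a, 'c, 'd) view \<Rightarrow> (real ^ 'd) multiset" where
  "core_embeddings \<pi> V = image_mset (embedding V) (mset_set (core \<pi> V))"

text \<open>The normalised median, or \<open>None\<close> in the degenerate case.\<close>

definition aggregate ::
    "('a, 'd::finite) params \<Rightarrow> ('a, 'c, 'd) view \<Rightarrow> (real ^ 'd) option" where
  "aggregate \<pi> V =
    (let M = core_embeddings \<pi> V; y = median \<pi> M
     in if degenerate \<pi> M y then None else Some (y /\<^sub>R norm y))"

definition semantic_digest ::
    "('a, 'c, 'd::finite, 's) system \<Rightarrow> ('c, 'd) tools \<Rightarrow> nat \<Rightarrow> ('a, 'c, 'd) view \<Rightarrow> real ^ 'd \<Rightarrow> bytes"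
  where
  "semantic_digest S T r V y = hash S
     (''semantic_commit'' @ canon T (Point (quantiser T y)) @ pi_digest S @
      canon T (Round r) @ canon T (Verdict (leading V)))"

definition verdict_digest ::
    "('a, 'c, 'd::finite, 's) system \<Rightarrow> ('c, 'd) tools \<Rightarrow> nat \<Rightarrow> ('a, 'c, 'd) view \<Rightarrow> bytes" where
  "verdict_digest S T r V = hash S
     (''verdict_commit'' @
      canon T (Payload (leading V) (card (verdict_group V (leading V))) (verdict_margin V)
                 (card (agents S)) (faults S) r) @
      pi_digest S @ canon T (Round r))"

text \<open>
  The decision rule (Stages 2 to 4) run with tools \<open>T\<close> on view \<open>V\<close>: commit type, digest and signer
  source, or \<open>None\<close> for an abort. A degenerate aggregate aborts and does not fall back to a verdict
  commit.
\<close>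

definition decide ::
    "('a, 'c, 'd::finite, 's) system \<Rightarrow> ('c, 'd) tools \<Rightarrow> nat \<Rightarrow> ('a, 'c, 'd) view \<Rightarrow>
     (commit_type \<times> bytes \<times> 'a set) option" where
  "decide S T r V =
    (let \<pi> = params S; G = verdict_group V (leading V) in
     if card G < 2 * faults S + 1 then None
     else if semantic_ok \<pi> (faults S) V then
       (case aggregate \<pi> V of
          None \<Rightarrow> None
        | Some y \<Rightarrow> Some (Semantic_commit, semantic_digest S T r V y, core \<pi> V))
     else if 1 \<le> verdict_margin V then
       Some (Verdict_commit, verdict_digest S T r V, G)
     else None)"

definition local_decision ::
    "('a, 'c, 'd::finite, 's) system \<Rightarrow> 'a \<Rightarrow> nat \<Rightarrow> (commit_type \<times> bytes \<times> 'a set) option" where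
  "local_decision S k r =
    (case local_view S k r of None \<Rightarrow> None | Some V \<Rightarrow> decide S (tools S k) r V)"


subsection \<open>Stage 5: certificates\<close>

text \<open>
  \<open>publishes S k r Ob\<close>: \<open>Ob\<close> is a possible output of node \<open>k\<close>, depending on the signatures it has
  collected, which may differ between nodes. Injectivity of \<^const>\<open>fst\<close> on the certificate
  means one signature per identity.
\<close>

definition publishes ::
    "('a, 'c, 'd::finite, 's) system \<Rightarrow> 'a \<Rightarrow> nat \<Rightarrow> ('a, 's) commit_object \<Rightarrow> bool" where
  "publishes S k r Ob \<longleftrightarrow>
    (\<exists>src. local_decision S k r = Some (ctype Ob, digest Ob, src) \<and>
       cert Ob \<subseteq> inbox S k r \<and>
       (\<forall>(s, \<sigma>) \<in> cert Ob. s \<in> src \<and> verify S s (digest Ob) \<sigma>) \<and>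
       inj_on fst (cert Ob) \<and>
       2 * faults S + 1 \<le> card (fst ` cert Ob))"

definition binds ::
    "('a, 'c, 'd::finite, 's) system \<Rightarrow> ('a \<times> 's) set \<Rightarrow> nat \<Rightarrow> bytes \<Rightarrow> bool" where
  "binds S crt m h \<longleftrightarrow> m \<le> card {s \<in> agents S. \<exists>\<sigma>. (s, \<sigma>) \<in> crt \<and> verify S s h \<sigma>}"


subsection \<open>Assumptions\<close>

definition fault_model :: "('a, 'c, 'd::finite, 's) system \<Rightarrow> bool" where
  "fault_model S \<longleftrightarrow> finite (agents S) \<and> 3 * faults S + 1 \<le> card (agents S) \<and>
     byzantine S \<subseteq> agents S \<and> card (byzantine S) \<le> faults S"

definition valid_params :: "('a, 'd::finite) params \<Rightarrow> bool" where
  "valid_params \<pi> \<longleftrightarrow> 0 < eta \<pi> \<and>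
     (\<forall>K. K \<noteq> {} \<longrightarrow> tie_break \<pi> K \<in> K) \<and>
     (\<forall>M. M \<noteq> {#} \<longrightarrow> is_geometric_median M (median \<pi> M)) \<and>
     (\<forall>M. degenerate \<pi> M 0)"

text \<open>
  Coordinatewise rounding to the lattice with step \<open>\<eta>\<close>. The function \<open>rnd\<close> is rounding to a nearest
  integer and fixes the tie-break.
\<close>

definition lattice_rounding :: "real \<Rightarrow> (real ^ 'd::finite \<Rightarrow> real ^ 'd) \<Rightarrow> bool" where
  "lattice_rounding \<eta> Q \<longleftrightarrow>
     (\<exists>rnd :: real \<Rightarrow> int. (\<forall>x. \<bar>real_of_int (rnd x) - x\<bar> \<le> 1 / 2) \<and>
        (\<forall>y. Q y = (\<chi> c. \<eta> * real_of_int (rnd (y $ c / \<eta>)))))"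

definition valid_tools :: "('a, 'c, 'd::finite, 's) system \<Rightarrow> bool" where
  "valid_tools S \<longleftrightarrow> (\<forall>k \<in> honest S.
     (\<forall>t. norm (encoder (tools S k) t) = 1) \<and>
     lattice_rounding (eta (params S)) (quantiser (tools S k)))"

definition valid_delivery :: "('a, 'c, 'd::finite, 's) system \<Rightarrow> bool" where
  "valid_delivery S \<longleftrightarrow> (\<forall>k \<in> honest S. \<forall>r D. delivered S k r = Some D \<longrightarrow>
     dom D \<subseteq> agents S \<and> card (agents S) - faults S \<le> card (dom D))"

definition hcsc_system :: "('a, 'c, 'd::finite, 's) system \<Rightarrow> bool" where
  "hcsc_system S \<longleftrightarrow>
     fault_model S \<and> valid_params (params S) \<and> valid_tools S \<and> valid_delivery S"

definition deterministic_encoder :: "('a, 'c, 'd::finite, 's) system \<Rightarrow> bool" where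
  "deterministic_encoder S \<longleftrightarrow> (\<forall>i \<in> honest S. \<forall>j \<in> honest S. \<forall>t.
     encoder (tools S i) t = encoder (tools S j) t)"

definition deterministic_canon :: "('a, 'c, 'd::finite, 's) system \<Rightarrow> bool" where
  "deterministic_canon S \<longleftrightarrow> (\<forall>i \<in> honest S. \<forall>j \<in> honest S. \<forall>x.
     canon (tools S i) x = canon (tools S j) x)"

definition deterministic_quantiser :: "('a, 'c, 'd::finite, 's) system \<Rightarrow> bool" where
  "deterministic_quantiser S \<longleftrightarrow> (\<forall>i \<in> honest S. \<forall>j \<in> honest S. \<forall>y.
     quantiser (tools S i) y = quantiser (tools S j) y)"

text \<open>
  Unforgeability: a valid signature of an honest agent that reaches an honest agent stems from an
  act of signing, possibly in another round.
\<close>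

definition authenticated_channels :: "('a, 'c, 'd::finite, 's) system \<Rightarrow> bool" where
  "authenticated_channels S \<longleftrightarrow> (\<forall>k \<in> honest S. \<forall>s \<in> honest S. \<forall>r \<sigma> h.
     (s, \<sigma>) \<in> inbox S k r \<and> verify S s h \<sigma> \<longrightarrow> (\<exists>r' t. (t, h) \<in> signed S s r'))"

text \<open>The local decision is unique, so this includes signing at most one typed digest per round.\<close>

definition honest_sign_once :: "('a, 'c, 'd::finite, 's) system \<Rightarrow> bool" where
  "honest_sign_once S \<longleftrightarrow> (\<forall>s \<in> honest S. \<forall>r t h. (t, h) \<in> signed S s r \<longrightarrow>
     (\<exists>src. local_decision S s r = Some (t, h, src)))"

text \<open>
  All honest nodes complete reliable broadcast with the same index set and the same proposals.
  That their views then also agree on the embeddings is a consequence of determinism of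
  encoder and canonicalisation, and is not assumed here.
\<close>

definition successful_round :: "('a, 'c, 'd::finite, 's) system \<Rightarrow> nat \<Rightarrow> bool" where
  "successful_round S r \<longleftrightarrow> (\<exists>D. \<forall>k \<in> honest S. delivered S k r = Some D)"

end

theory Submission
  imports Defs
begin

text \<open>
  The decision rule is a function of the delivered proposals and of the values returned by the
  node's tools, so determinism forces all honest nodes to the same type and digest. For the
  certificates it remains to see that the signer source consists of agents: it is a set of
  delivered agents, for the core because the tie-break chooses among components of the leading
  verdict group.
\<close>

lemma verdict_group_subset_dom: "verdict_group V v \<subseteq> dom V"
  by (auto simp: verdict_group_def)

text \<open>Every edge has both endpoints in \<open>G\<close>, so a path that starts in
  \<open>G\<close> never leaves it. The start must be known to lie in \<open>G\<close>, since the
  reflexive closure also relates each point outside \<open>G\<close> to itself.\<close>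

lemma angle_component_subset:
  assumes "C \<in> angle_components \<pi> V G"
  shows "C \<subseteq> G"
proof -
  have "y \<in> G" if "(x, y) \<in> (angle_graph \<pi> V G)\<^sup>*" "x \<in> G" for x y
    using that by (induction rule: rtrancl_induct) (auto simp: angle_graph_def)
  with assms show ?thesis
    by (auto simp: angle_components_def quotient_def)
qed

lemma core_subset_verdict_group:
  assumes "valid_params \<pi>" and "finite (verdict_group V (leading V))"
    and "verdict_group V (leading V) \<noteq> {}"
  shows "core \<pi> V \<subseteq> verdict_group V (leading V)"
proof -
  let ?K = "angle_components \<pi> V (verdict_group V (leading V))"
  let ?L = "{C \<in> ?K. \<forall>C' \<in> ?K. card C' \<le> card C}"
  have "finite ?K" and "?K \<noteq> {}"
    using assms(2,3) by (auto simp: angle_components_def quotient_def)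
  \<comment> \<open>\<open>valid_params\<close> constrains \<open>tie_break\<close> only on nonempty
    families, so a largest component must be exhibited: one whose cardinality attains the maximum
    over the finite nonempty \<open>?K\<close>.\<close>
  then have "Max (card ` ?K) \<in> card ` ?K" and "\<And>C'. C' \<in> ?K \<Longrightarrow> card C' \<le> Max (card ` ?K)"
    by simp_all
  then have "?L \<noteq> {}"
    by auto
  then have "tie_break \<pi> ?L \<in> ?L"
    by (rule assms(1)[unfolded valid_params_def, THEN conjunct2, THEN conjunct1, rule_format])
  then have "core \<pi> V \<in> ?L"
    by (simp only: core_def Let_def)
  then show ?thesis
    using angle_component_subset by blast
qed

text \<open>Each branch that does not abort draws its signers from the leading group: the semantic
  path from the core inside it, the verdict path from the group itself.\<close>

lemma decide_source_subset_dom: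
  assumes "decide S T r V = Some (t, h, src)"
    and "valid_params (params S)" and "finite (dom V)"
  shows "src \<subseteq> dom V"
proof -
  let ?G = "verdict_group V (leading V)"
  have "finite ?G"
    using assms(3) verdict_group_subset_dom by (rule rev_finite_subset)
  \<comment> \<open>A decision was returned, so the Stage 2 abort did not fire; the threshold is
    positive even for f = 0, which excludes the empty group.\<close>
  moreover have "card ?G \<ge> 2 * faults S + 1"
    using assms(1) by (auto simp: decide_def Let_def split: if_splits)
  then have "?G \<noteq> {}"
    by force
  ultimately have "core (params S) V \<subseteq> ?G"
    by (rule core_subset_verdict_group[OF assms(2)])
  moreover have "src = core (params S) V \<or> src = ?G"
    using assms(1) by (auto simp: decide_def Let_def split: if_splits option.splits)
  ultimately have "src \<subseteq> ?G"
    by auto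
  then show ?thesis
    using verdict_group_subset_dom by (rule subset_trans)
qed

lemma local_decision_source_subset_agents:
  assumes "hcsc_system S" and "k \<in> honest S" and "local_decision S k r = Some (t, h, src)"
  shows "src \<subseteq> agents S"
proof -
  from assms(3) obtain D where D: "delivered S k r = Some D"
    and dec: "decide S (tools S k) r (attach_embeddings (tools S k) D) = Some (t, h, src)"
    by (auto simp: local_decision_def local_view_def split: option.splits)
  have dom: "dom (attach_embeddings (tools S k) D) = dom D"
    by (auto simp: attach_embeddings_def)
  have sub: "dom D \<subseteq> agents S" and fin: "finite (agents S)" and "valid_params (params S)"
    using assms(1,2) D by (auto simp: hcsc_system_def valid_delivery_def fault_model_def)
  moreover have "finite (dom D)"
    using fin sub by (rule rev_finite_subset)
  ultimately show ?thesis
    using decide_source_subset_dom[OF dec] dom by auto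
qed

text \<open>The encoder acts only when the view is formed; with \<open>V\<close> fixed, tools enter
  only through the two digests, by serialisation and quantisation.\<close>

lemma decide_cong:
  assumes "canon T = canon T'" and "quantiser T = quantiser T'"
  shows "decide S T r V = decide S T' r V"
  by (simp only: decide_def semantic_digest_def verdict_digest_def assms)

lemma attach_embeddings_cong:
  assumes "canon T = canon T'" and "encoder T = encoder T'"
  shows "attach_embeddings T D = attach_embeddings T' D"
  by (simp only: attach_embeddings_def assms)

lemma local_decision_eq_decide:
  assumes "delivered S k r = Some D"
  shows "local_decision S k r = decide S (tools S k) r (attach_embeddings (tools S k) D)"
  using assms by (simp add: local_decision_def local_view_def)

lemma local_decision_agree:
  assumes "deterministic_encoder S" and "deterministic_canon S" and "deterministic_quantiser S"
    and "successful_round S r" and "i \<in> honest S" and "j \<in> honest S"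
  shows "local_decision S i r = local_decision S j r"
proof -
  have enc: "encoder (tools S i) = encoder (tools S j)"
    using assms(1,5,6) unfolding deterministic_encoder_def by blast
  have can: "canon (tools S i) = canon (tools S j)"
    using assms(2,5,6) unfolding deterministic_canon_def by blast
  have qua: "quantiser (tools S i) = quantiser (tools S j)"
    using assms(3,5,6) unfolding deterministic_quantiser_def by blast
  obtain D where D: "delivered S i r = Some D" "delivered S j r = Some D"
    using assms(4-6) unfolding successful_round_def by blast
  have "local_decision S i r = decide S (tools S i) r (attach_embeddings (tools S i) D)"
    using D(1) by (rule local_decision_eq_decide)
  \<comment> \<open>The tools are exchanged in two stages: first inside the view, then in the
    decision rule run on the now common view.\<close>
  also have "attach_embeddings (tools S i) D = attach_embeddings (tools S j) D"
    using can enc by (rule attach_embeddings_cong)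
  also have "decide S (tools S i) r \<dots> = decide S (tools S j) r \<dots>"
    using can qua by (rule decide_cong)
  also have "\<dots> = local_decision S j r"
    using D(2) by (rule local_decision_eq_decide[symmetric])
  finally show ?thesis .
qed

text \<open>The protocol counts identities occurring in the certificate, whereas
  \<open>binds\<close> counts agents; the inclusion of the signer source in \<open>agents S\<close>
  bridges the two.\<close>

lemma publishes_binds:
  assumes "hcsc_system S" and "k \<in> honest S" and "publishes S k r Ob"
  shows "binds S (cert Ob) (2 * faults S + 1) (digest Ob)"
proof -
  let ?B = "{s \<in> agents S. \<exists>\<sigma>. (s, \<sigma>) \<in> cert Ob \<and> verify S s (digest Ob) \<sigma>}"
  obtain src where dec: "local_decision S k r = Some (ctype Ob, digest Ob, src)"
    and valid: "\<forall>(s, \<sigma>) \<in> cert Ob. s \<in> src \<and> verify S s (digest Ob) \<sigma>"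
    and card: "2 * faults S + 1 \<le> card (fst ` cert Ob)"
    using assms(3) by (auto simp: publishes_def)
  have "src \<subseteq> agents S"
    using local_decision_source_subset_agents[OF assms(1,2) dec] .
  with valid have "fst ` cert Ob \<subseteq> ?B"
    by fastforce
  moreover have "finite ?B"
    using assms(1) by (simp add: hcsc_system_def fault_model_def)
  ultimately have "card (fst ` cert Ob) \<le> card ?B"
    by (intro card_mono)
  with card show ?thesis
    by (simp add: binds_def)
qed

theorem theorem5p1:
  fixes S :: "('a, 'c, 'd::finite, 's) system"
    and r :: nat
    and i j :: 'a
    and Oi Oj :: "('a, 's) commit_object"
  assumes "hcsc_system S"
    and "authenticated_channels S"
    and "honest_sign_once S"
    and "deterministic_encoder S"
    and "deterministic_canon S"
    and "deterministic_quantiser S"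
    and "successful_round S r"
    and "i \<in> honest S" and "j \<in> honest S"
    and "publishes S i r Oi" and "publishes S j r Oj"
  shows "\<exists>t hstar.
    ctype Oi = t \<and> ctype Oj = t \<and> digest Oi = hstar \<and> digest Oj = hstar \<and>
    binds S (cert Oi) (2 * faults S + 1) hstar \<and>
    binds S (cert Oj) (2 * faults S + 1) hstar"
proof -
  have "local_decision S i r = local_decision S j r"
    using assms(4-9) by (rule local_decision_agree)
  \<comment> \<open>Both objects copy type and digest from the same \<open>Some\<close> value,
    whatever signatures each verifier collected.\<close>
  with assms(10,11) have "ctype Oi = ctype Oj" and "digest Oi = digest Oj"
    by (auto simp: publishes_def)
  then show ?thesis
    using publishes_binds[OF assms(1,8,10)] publishes_binds[OF assms(1,9,11)] by auto
qed

end
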